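(* Let $X$ and $Y$ be real Banach spaces, at least one of which has the Daugavet property. Then \[T(X\oplus_1 Y)=\min\{T(X),T(Y)\}.\]
   Context: All Banach spaces are real and nonzero. For a Banach space $X$, $B_X$ and $S_X$ denote its closed unit ball and unit sphere, and $B(x,r)$ is the ball with centre $x$ and radius $r$. A subset $W\subset B_X$ is relatively weakly open if it is the intersection of $B_X$ with a weakly open subset of $X$. The Daugavet index of thickness of $X$ is \[T(X)=\inf\{r>0 : \text{there are } x\in S_X \text{ and a non-empty relatively weakly open } W\subset B_X \text{ such that } W\subset B(x,r)\}.\] A Banach space $X$ has the Daugavet property if $\|I+R\|=1+\|R\|$ for every rank-one bounded linear operator $R\colon X\to X$; this is equivalent to $T(X)=2$. If $X$ has the Daugavet property then for every $x\in S_X$, every non-empty relatively weakly open subset $U$ of $B_X$ and every $\varepsilon>0$ there is $u\in U$ with $\|x-u\|>2-\varepsilon$. $X\oplus_1 Y$ is the space $X\times Y$ with the norm $\|(x,y)\|=\|x\|+\|y\|$. *)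

theory Defs
  imports "HOL-Analysis.Analysis"
begin

definition weak_topology :: "'a::real_normed_vector topology" where
  "weak_topology =
     topology_generated_by {blinfun_apply f -` U | (f :: 'a \<Rightarrow>\<^sub>L real) U. open U}"

(* On a nonzero space the set below contains every r >= 2 (take W the whole unit ball), so the
   real-valued Inf is the genuine infimum. Replacing closed balls by open ones does not change it. *)
definition daugavet_thickness :: "'a::real_normed_vector itself \<Rightarrow> real" where
  "daugavet_thickness TYPE('a) =
     Inf {r. r > 0 \<and> (\<exists>x \<in> sphere (0::'a) 1. \<exists>W.
            openin (subtopology weak_topology (cball 0 1)) W \<and> W \<noteq> {} \<and> W \<subseteq> cball x r)}"

definition daugavet_property :: "'a::real_normed_vector itself \<Rightarrow> bool" where
  "daugavet_property TYPE('a) \<longleftrightarrow>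
     (\<forall>R :: 'a \<Rightarrow>\<^sub>L 'a. dim (range (blinfun_apply R)) = 1 \<longrightarrow>
        norm (id_blinfun + R) = 1 + norm R)"

(* A separate type is needed because the product type carries the Euclidean product norm. *)
datatype ('a, 'b) l1_sum = L1_Pair (l1_fst: 'a) (l1_snd: 'b)

instantiation l1_sum :: (real_vector, real_vector) real_vector
begin

definition "0 = L1_Pair 0 0"
definition "x + y = L1_Pair (l1_fst x + l1_fst y) (l1_snd x + l1_snd y)"
definition "x - y = L1_Pair (l1_fst x - l1_fst y) (l1_snd x - l1_snd y)"
definition "- x = L1_Pair (- l1_fst x) (- l1_snd x)"
definition "c *\<^sub>R x = L1_Pair (c *\<^sub>R l1_fst x) (c *\<^sub>R l1_snd x)"

instance
  by standard
    (auto simp: zero_l1_sum_def plus_l1_sum_def minus_l1_sum_def uminus_l1_sum_def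
      scaleR_l1_sum_def algebra_simps)

end

instantiation l1_sum :: (real_normed_vector, real_normed_vector) real_normed_vector
begin

definition norm_l1_sum_def:
  "norm (x :: ('a, 'b) l1_sum) = norm (l1_fst x) + norm (l1_snd x)"
definition dist_l1_sum_def:
  "dist (x :: ('a, 'b) l1_sum) y = norm (x - y)"
definition sgn_l1_sum_def:
  "sgn (x :: ('a, 'b) l1_sum) = inverse (norm x) *\<^sub>R x"
definition uniformity_l1_sum_def:
  "(uniformity :: (('a, 'b) l1_sum \<times> ('a, 'b) l1_sum) filter) =
     (INF e\<in>{0 <..}. principal {(x, y). dist x y < e})"
definition open_l1_sum_def:
  "open (U :: ('a, 'b) l1_sum set) \<longleftrightarrow>
     (\<forall>x\<in>U. eventually (\<lambda>(x', y). x' = x \<longrightarrow> y \<in> U) uniformity)"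

instance
proof
  fix x y :: "('a, 'b) l1_sum" and a :: real
  show "norm x = 0 \<longleftrightarrow> x = 0"
    by (cases x) (simp add: norm_l1_sum_def zero_l1_sum_def add_nonneg_eq_0_iff)
  show "norm (x + y) \<le> norm x + norm y"
    using norm_triangle_ineq[of "l1_fst x" "l1_fst y"] norm_triangle_ineq[of "l1_snd x" "l1_snd y"]
    by (simp add: norm_l1_sum_def plus_l1_sum_def)
  show "norm (a *\<^sub>R x) = \<bar>a\<bar> * norm x"
    by (simp add: norm_l1_sum_def scaleR_l1_sum_def algebra_simps)
qed (rule dist_l1_sum_def sgn_l1_sum_def uniformity_l1_sum_def open_l1_sum_def)+

end

lemma dist_l1_sum: "dist x y = dist (l1_fst x) (l1_fst y) + dist (l1_snd x) (l1_snd y)"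
  by (simp add: dist_l1_sum_def norm_l1_sum_def minus_l1_sum_def dist_norm)

instance l1_sum :: (banach, banach) banach
proof
  fix X :: "nat \<Rightarrow> ('a, 'b) l1_sum"
  assume X: "Cauchy X"
  have le: "dist (l1_fst x) (l1_fst y) \<le> dist x y" "dist (l1_snd x) (l1_snd y) \<le> dist x y"
    for x y :: "('a, 'b) l1_sum"
    by (simp_all add: dist_l1_sum)
  have "Cauchy (\<lambda>n. l1_fst (X n))" "Cauchy (\<lambda>n. l1_snd (X n))"
    using X unfolding Cauchy_def by (meson le le_less_trans)+
  then obtain a b where ab: "(\<lambda>n. l1_fst (X n)) \<longlonglongrightarrow> a" "(\<lambda>n. l1_snd (X n)) \<longlonglongrightarrow> b"
    unfolding Cauchy_convergent_iff convergent_def by blast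
  have "(\<lambda>n. dist (l1_fst (X n)) a + dist (l1_snd (X n)) b) \<longlonglongrightarrow> 0 + 0"
    by (intro tendsto_add) (use ab in \<open>simp_all add: tendsto_dist_iff[symmetric]\<close>)
  then have "(\<lambda>n. dist (X n) (L1_Pair a b)) \<longlonglongrightarrow> 0"
    by (simp add: dist_l1_sum)
  then show "convergent X"
    unfolding convergent_def using tendsto_dist_iff by blast
qed

end

theory Submission
  imports Defs
begin

text \<open>
  Write \<open>Z\<close> for the l1-sum of \<open>X\<close> and \<open>Y\<close>, and let \<open>X\<close> be the summand with the Daugavet property.
  The result follows from \<open>T(Z) \<le> T(X)\<close>, \<open>T(Z) \<le> T(Y)\<close> and \<open>T(Y) \<le> T(Z)\<close>.

  The upper bounds hold for every l1-sum (\<open>thickness_le_left\<close>). A weakly open piece of the ball of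
  \<open>X\<close> that lies in a small ball can be chosen to contain a point \<open>y\<close> of norm one
  (\<open>thin_weak_nbhd_on_sphere\<close>). If \<open>g\<close> is a functional of norm one with \<open>g y = 1\<close>, the
  points of the ball of \<open>Z\<close> whose \<open>X\<close>-component is weakly close to \<open>y\<close> and almost maximises
  \<open>g\<close> have almost all of their norm in that component. They are therefore as close to the given
  unit vector of \<open>X\<close> as their components are, up to an arbitrarily small error.

  For the lower bound (\<open>thickness_ge_right\<close>) take a unit vector \<open>(x0, y0)\<close> of \<open>Z\<close> and a point
  \<open>(u, v)\<close> of a weakly open piece of its ball. The Daugavet property moves \<open>u\<close>, within the
  ball of radius \<open>norm u\<close> and within a weak neighbourhood, to distance almost
  \<open>norm x0 + norm u\<close> from \<open>x0\<close>. The definition of \<open>T(Y)\<close> moves \<open>v\<close>, within the ball of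
  radius \<open>1 - norm u\<close>, to distance almost \<open>T(Y) - (1 - norm y0) - norm u\<close> from \<open>y0\<close>. Since
  \<open>norm x0 + norm y0 = 1\<close>, the two distances add up to \<open>T(Y)\<close>.

  The first of these moves needs the passage from rank-one operators to weakly open sets
  (\<open>daugavet_weak_nbhd\<close>). The norm equation gives far points in every slice directly
  (\<open>daugavet_slice\<close>). For a finite set of functionals, the points that have weakly close points
  as far as possible from every vector form a convex set (\<open>convex_everywhere_far\<close>). This set meets
  each slice, because each slice contains a slice on which the functionals hardly vary
  (\<open>slice_small_oscillation\<close>). By the Hahn-Banach theorem it is therefore norm-dense in the ball.
  This replaces the usual argument through extreme points of the bidual ball.
\<close>

section \<open>Separation in normed spaces\<close>

definition sublinear_below_norm :: "('a::real_normed_vector \<Rightarrow> real) \<Rightarrow> bool" where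
  "sublinear_below_norm p \<longleftrightarrow>
     (\<forall>x y. p (x + y) \<le> p x + p y) \<and> (\<forall>c x. 0 < c \<longrightarrow> p (c *\<^sub>R x) \<le> c * p x) \<and> (\<forall>x. p x \<le> norm x)"

lemma sublinear_below_normD:
  assumes "sublinear_below_norm p"
  shows "p (x + y) \<le> p x + p y" "0 < c \<Longrightarrow> p (c *\<^sub>R x) \<le> c * p x" "p x \<le> norm x"
  using assms by (auto simp: sublinear_below_norm_def)

lemma sublinear_below_norm_scaleR:
  assumes p: "sublinear_below_norm p" and c: "0 < c"
  shows "p (c *\<^sub>R x) = c * p x"
proof -
  have "p (inverse c *\<^sub>R (c *\<^sub>R x)) \<le> inverse c * p (c *\<^sub>R x)"
    using sublinear_below_normD(2)[OF p, of "inverse c" "c *\<^sub>R x"] c by simp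
  then have "c * p x \<le> p (c *\<^sub>R x)"
    using c by (simp add: field_simps)
  with sublinear_below_normD(2)[OF p c] show ?thesis by (simp add: antisym)
qed

lemma sublinear_below_norm_zero:
  assumes p: "sublinear_below_norm p"
  shows "p 0 = 0"
  using sublinear_below_norm_scaleR[OF p, of 2 0] by simp

lemma sublinear_below_norm_lower:
  assumes p: "sublinear_below_norm p"
  shows "- p (- x) \<le> p x" "- norm x \<le> p x"
proof -
  show *: "- p (- x) \<le> p x"
    using sublinear_below_normD(1)[OF p, of x "- x"] sublinear_below_norm_zero[OF p] by simp
  show "- norm x \<le> p x"
    using * sublinear_below_normD(3)[OF p, of "- x"] by simp
qed

text \<open>The function \<open>q x = Inf (p (x + t *\<^sub>R z) - t * d)\<close> over \<open>t \<ge> 0\<close> and \<open>z \<in> D\<close> does it. Convexity of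
  \<open>D\<close> makes \<open>q\<close> subadditive, and \<open>t = 1\<close> gives the bound at \<open>- z\<close>. A linear functional below
  \<open>q\<close> is at least \<open>d\<close> on \<open>D\<close>; with \<open>D\<close> a single point the lemma also shows that minimal
  sublinear functions are odd.\<close>

lemma sublinear_below_norm_decrease:
  fixes p :: "'a::real_normed_vector \<Rightarrow> real"
  assumes p: "sublinear_below_norm p" and D: "convex D" "D \<noteq> {}"
    and d: "\<And>z. z \<in> D \<Longrightarrow> d \<le> p z"
  shows "\<exists>q. sublinear_below_norm q \<and> q \<le> p \<and> (\<forall>z\<in>D. q (- z) \<le> - d)"
proof -
  define V where "V x = {p (x + t *\<^sub>R z) - t * d |t z. 0 \<le> t \<and> z \<in> D}" for x
  define q where "q x = Inf (V x)" for x
  have low: "- p (- x) \<le> v" if "v \<in> V x" for x v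
  proof -
    have "\<exists>t z. v = p (x + t *\<^sub>R z) - t * d \<and> 0 \<le> t \<and> z \<in> D"
      using that by (simp only: V_def mem_Collect_eq)
    then obtain t z where tz: "v = p (x + t *\<^sub>R z) - t * d" "0 \<le> t" "z \<in> D"
      by (elim exE conjE)
    have "t * d \<le> p (t *\<^sub>R z)"
    proof (cases "t = 0")
      case False
      then show ?thesis
        using tz d[of z] sublinear_below_norm_scaleR[OF p, of t z] by (simp add: mult_left_mono)
    qed (simp add: sublinear_below_norm_zero[OF p])
    also have "p (t *\<^sub>R z) \<le> p (x + t *\<^sub>R z) + p (- x)"
      using sublinear_below_normD(1)[OF p, of "x + t *\<^sub>R z" "- x"] by simp
    finally show ?thesis using tz by simp
  qed
  have bdd: "bdd_below (V x)" for x
    using low by (meson bdd_belowI)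
  have ne: "V x \<noteq> {}" for x
    using D(2) by (auto simp: V_def intro: exI[of _ 0])
  have qle: "q x \<le> p (x + t *\<^sub>R z) - t * d" if "0 \<le> t" "z \<in> D" for x t z
    unfolding q_def by (rule cInf_lower[OF _ bdd]) (use that in \<open>auto simp: V_def\<close>)
  have qge: "m \<le> q x" if "\<And>t z. 0 \<le> t \<Longrightarrow> z \<in> D \<Longrightarrow> m \<le> p (x + t *\<^sub>R z) - t * d" for m x
    unfolding q_def by (rule cInf_greatest[OF ne]) (use that in \<open>auto simp: V_def\<close>)
  obtain z0 where z0: "z0 \<in> D" using D(2) by auto
  have qp: "q x \<le> p x" for x
    using qle[of 0 z0 x] z0 by simp
  have add: "q (x + y) \<le> q x + q y" for x y
  proof -
    have "q (x + y) - q y \<le> p (x + t *\<^sub>R z) - t * d" if tz: "0 \<le> t" "z \<in> D" for t z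
    proof -
      have "q (x + y) - (p (x + t *\<^sub>R z) - t * d) \<le> p (y + s *\<^sub>R w) - s * d"
        if sw: "0 \<le> s" "w \<in> D" for s w
      proof (cases "t + s = 0")
        case True
        then have "t = 0" "s = 0" using tz sw by auto
        then show ?thesis using qp[of "x + y"] sublinear_below_normD(1)[OF p, of x y] by simp
      next
        case False
        then have ts: "0 < t + s" using tz sw by simp
        define v where "v = (t / (t + s)) *\<^sub>R z + (s / (t + s)) *\<^sub>R w"
        have "v \<in> D"
          unfolding v_def using tz sw ts
          by (intro convexD[OF D(1)]) (auto simp: add_divide_distrib[symmetric])
        moreover have "(t + s) *\<^sub>R v = t *\<^sub>R z + s *\<^sub>R w"
          using ts by (simp add: v_def scaleR_right_distrib)
        ultimately have "q (x + y) \<le> p (x + y + (t *\<^sub>R z + s *\<^sub>R w)) - (t + s) * d"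
          using qle[of "t + s" v "x + y"] ts by simp
        also have "p (x + y + (t *\<^sub>R z + s *\<^sub>R w)) \<le> p (x + t *\<^sub>R z) + p (y + s *\<^sub>R w)"
          using sublinear_below_normD(1)[OF p, of "x + t *\<^sub>R z" "y + s *\<^sub>R w"]
          by (simp add: algebra_simps)
        finally show ?thesis by (simp add: algebra_simps)
      qed
      from qge[OF this] show ?thesis by simp
    qed
    from qge[OF this] show ?thesis by simp
  qed
  have scale: "q (c *\<^sub>R x) \<le> c * q x" if c: "0 < c" for c x
  proof -
    have "q (c *\<^sub>R x) / c \<le> p (x + t *\<^sub>R z) - t * d" if tz: "0 \<le> t" "z \<in> D" for t z
    proof -
      have "q (c *\<^sub>R x) \<le> p (c *\<^sub>R (x + t *\<^sub>R z)) - c * t * d"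
        using qle[of "c * t" z "c *\<^sub>R x"] tz c by (simp add: algebra_simps)
      also have "\<dots> = c * (p (x + t *\<^sub>R z) - t * d)"
        by (simp only: sublinear_below_norm_scaleR[OF p c]) (simp add: algebra_simps)
      finally show ?thesis using c by (simp add: field_simps)
    qed
    from qge[OF this] show ?thesis using c by (simp add: field_simps)
  qed
  have "sublinear_below_norm q"
    unfolding sublinear_below_norm_def
    using add scale order_trans[OF qp sublinear_below_normD(3)[OF p]] by blast
  moreover have "q (- z) \<le> - d" if "z \<in> D" for z
    using qle[of 1 z "- z"] that sublinear_below_norm_zero[OF p] by simp
  ultimately show ?thesis using qp by (auto simp: le_fun_def)
qed

lemma sublinear_below_norm_Inf_chain:
  fixes C :: "('a::real_normed_vector \<Rightarrow> real) set"
  assumes sub: "\<And>p. p \<in> C \<Longrightarrow> sublinear_below_norm p"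
    and chain: "\<And>p q. p \<in> C \<Longrightarrow> q \<in> C \<Longrightarrow> p \<le> q \<or> q \<le> p" and ne: "C \<noteq> {}"
  shows "sublinear_below_norm (\<lambda>x. INF p\<in>C. p x)" "q \<in> C \<Longrightarrow> (\<lambda>x. INF p\<in>C. p x) \<le> q"
proof -
  let ?q = "\<lambda>x. INF p\<in>C. p x"
  have bdd: "bdd_below ((\<lambda>p. p x) ` C)" for x
    by (rule bdd_belowI2[of _ "- norm x"]) (use sub sublinear_below_norm_lower(2) in blast)
  have low: "?q x \<le> p x" if "p \<in> C" for p x
    by (rule cINF_lower[OF bdd that])
  have "?q (x + y) \<le> ?q x + ?q y" for x y
  proof -
    have le: "?q (x + y) \<le> p1 x + p2 y" if p: "p1 \<in> C" "p2 \<in> C" for p1 p2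
    proof -
      obtain p where "p \<in> C" "p \<le> p1" "p \<le> p2" using chain[OF p] p by auto
      then show ?thesis
        using low[of p "x + y"] sublinear_below_normD(1)[OF sub, of p x y]
        by (smt (verit) le_funD)
    qed
    then have "?q (x + y) - p1 x \<le> ?q y" if "p1 \<in> C" for p1
    proof (intro cINF_greatest[OF ne])
      fix p2 assume "p2 \<in> C"
      from le[OF that this]
      show "?q (x + y) - p1 x \<le> p2 y" by linarith
    qed
    then have "?q (x + y) - ?q y \<le> ?q x"
      by (intro cINF_greatest[OF ne]) (simp add: algebra_simps)
    then show ?thesis by simp
  qed
  moreover have "?q (c *\<^sub>R x) \<le> c * ?q x" if c: "0 < c" for c x
  proof -
    have "?q (c *\<^sub>R x) / c \<le> p x" if "p \<in> C" for p
      using low[OF that, of "c *\<^sub>R x"] sublinear_below_norm_scaleR[OF sub[OF that] c, of x] c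
      by (simp add: field_simps)
    then have "?q (c *\<^sub>R x) / c \<le> ?q x"
      by (rule cINF_greatest[OF ne])
    then show ?thesis using c by (simp add: field_simps)
  qed
  moreover have "?q x \<le> norm x" for x
  proof -
    obtain p where "p \<in> C" using ne by blast
    then show ?thesis using low sublinear_below_normD(3)[OF sub] by (blast intro: order_trans)
  qed
  ultimately show "sublinear_below_norm ?q"
    by (auto simp: sublinear_below_norm_def)
  show "?q \<le> q" if "q \<in> C"
    using low[OF that] by (simp add: le_fun_def)
qed

text \<open>Below \<open>p\<close> there is a minimal sublinear function by Zorn's lemma. It is odd, since otherwise
  it could be decreased at a point, and an odd sublinear function is linear.\<close>

lemma sublinear_below_norm_dominates_linear:
  fixes p :: "'a::real_normed_vector \<Rightarrow> real"
  assumes p: "sublinear_below_norm p"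
  shows "\<exists>f :: 'a \<Rightarrow>\<^sub>L real. norm f \<le> 1 \<and> (\<forall>x. blinfun_apply f x \<le> p x)"
proof -
  let ?A = "{q. sublinear_below_norm q \<and> q \<le> p}"
  have "\<exists>m\<in>?A. \<forall>a\<in>?A. m \<ge> a \<longrightarrow> a = m"
  proof (rule predicate_Zorn)
    show "partial_order_on ?A (relation_of (\<ge>) ?A)"
      by (rule partial_order_on_relation_ofI) auto
    fix C assume C: "C \<in> Chains (relation_of (\<ge>) ?A)"
    show "\<exists>u\<in>?A. \<forall>a\<in>C. a \<ge> u"
    proof (cases "C = {}")
      case True
      then show ?thesis using p by auto
    next
      case False
      have sub: "C \<subseteq> ?A" using C by (auto simp: Chains_def relation_of_def)
      have chain: "\<And>p q. p \<in> C \<Longrightarrow> q \<in> C \<Longrightarrow> p \<le> q \<or> q \<le> p"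
        using C by (auto simp: Chains_def relation_of_def)
      have S: "\<And>p. p \<in> C \<Longrightarrow> sublinear_below_norm p" using sub by auto
      note I = sublinear_below_norm_Inf_chain[OF S chain False]
      obtain q where "q \<in> C" using False by auto
      then have "(\<lambda>x. INF p\<in>C. p x) \<le> p" using I(2) sub by (blast intro: order_trans)
      with I show ?thesis by (intro bexI[of _ "\<lambda>x. INF p\<in>C. p x"] CollectI conjI ballI)
    qed
  qed
  then obtain m where m: "sublinear_below_norm m" "m \<le> p"
    and min0: "\<forall>a\<in>?A. a \<le> m \<longrightarrow> a = m" by blast
  have min: "a = m" if "sublinear_below_norm a" "a \<le> m" for a
    using min0 that order_trans[OF that(2) m(2)] by blast
  have odd: "m (- a) = - m a" for a
  proof -
    obtain q where q: "sublinear_below_norm q" "q \<le> m" "q (- a) \<le> - m a"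
      using sublinear_below_norm_decrease[OF m(1), of "{a}" "m a"] by auto
    then have "m (- a) \<le> - m a" using min[OF q(1,2)] by simp
    then show ?thesis using sublinear_below_norm_lower(1)[OF m(1), of a] by simp
  qed
  have add: "m (x + y) = m x + m y" for x y
    using sublinear_below_normD(1)[OF m(1), of x y] sublinear_below_normD(1)[OF m(1), of "- x" "- y"]
      odd[of "x + y"] odd[of x] odd[of y] by simp
  have scale: "m (c *\<^sub>R x) = c * m x" for c x
  proof -
    consider "c > 0" | "c = 0" | "- c > 0" by linarith
    then show ?thesis
    proof cases
      case 3
      then show ?thesis
        using sublinear_below_norm_scaleR[OF m(1) 3, of x] odd[of "c *\<^sub>R x"] by simp
    qed (use sublinear_below_norm_scaleR[OF m(1)] sublinear_below_norm_zero[OF m(1)] in auto)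
  qed
  have abs: "norm (m x) \<le> norm x * 1" for x
    using sublinear_below_norm_lower(2)[OF m(1), of x] sublinear_below_normD(3)[OF m(1), of x]
    by simp
  have bl: "bounded_linear m"
    by (rule bounded_linear_intro[OF add _ abs]) (simp add: scale)
  show ?thesis
  proof (intro exI conjI allI)
    show "norm (Blinfun m) \<le> 1"
      by (rule norm_blinfun_bound) (use abs in \<open>auto simp: bounded_linear_Blinfun_apply[OF bl]\<close>)
    show "blinfun_apply (Blinfun m) x \<le> p x" for x
      using m(2) by (simp add: bounded_linear_Blinfun_apply[OF bl] le_fun_def)
  qed
qed

text \<open>With \<open>D\<close> a single point this gives norming functionals; in general it separates a point from
  a convex set at positive distance.\<close>

lemma separate_convex_from_origin:
  fixes D :: "'a::real_normed_vector set"
  assumes "convex D" "D \<noteq> {}" "\<And>z. z \<in> D \<Longrightarrow> d \<le> norm z"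
  shows "\<exists>f :: 'a \<Rightarrow>\<^sub>L real. norm f \<le> 1 \<and> (\<forall>z\<in>D. d \<le> blinfun_apply f z)"
proof -
  have "sublinear_below_norm (norm :: 'a \<Rightarrow> real)"
    by (auto simp: sublinear_below_norm_def norm_triangle_ineq)
  from sublinear_below_norm_decrease[OF this assms]
  obtain q where q: "sublinear_below_norm q" "\<forall>z\<in>D. q (- z) \<le> - d" by blast
  from sublinear_below_norm_dominates_linear[OF q(1)]
  obtain f :: "'a \<Rightarrow>\<^sub>L real" where "norm f \<le> 1" and f: "\<And>x. blinfun_apply f x \<le> q x" by blast
  moreover have "d \<le> blinfun_apply f z" if "z \<in> D" for z
  proof -
    have "- blinfun_apply f z \<le> q (- z)" using f[of "- z"] by (simp only: blinfun.minus_right)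
    also have "\<dots> \<le> - d" using q(2) that by blast
    finally show ?thesis by simp
  qed
  ultimately show ?thesis by blast
qed

section \<open>Weak neighbourhoods in the unit ball\<close>

definition weak_nbhd ::
    "('a::real_normed_vector \<Rightarrow>\<^sub>L real) set \<Rightarrow> 'a \<Rightarrow> real \<Rightarrow> 'a set" where
  "weak_nbhd F w \<eta> = {y \<in> cball 0 1. \<forall>f\<in>F. \<bar>blinfun_apply f (y - w)\<bar> < \<eta>}"

lemma topspace_weak_topology [simp]: "topspace weak_topology = UNIV"
proof -
  have "openin weak_topology (UNIV :: 'a::real_normed_vector set)"
    unfolding weak_topology_def openin_topology_generated_by_iff
    by (rule generate_topology_on.Basis) (auto intro!: exI[of _ UNIV])
  then show ?thesis using openin_subset by (metis top.extremum_uniqueI)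
qed

lemma openin_weak_nbhd:
  assumes "finite F"
  shows "openin (subtopology weak_topology (cball 0 1)) (weak_nbhd F w \<eta>)"
proof -
  have vim: "openin weak_topology (blinfun_apply f -` U)" if "open U" for f :: "'a \<Rightarrow>\<^sub>L real" and U
    unfolding weak_topology_def openin_topology_generated_by_iff
    by (rule generate_topology_on.Basis) (use that in auto)
  have "openin weak_topology {y. \<forall>f\<in>F. \<bar>blinfun_apply f (y - w)\<bar> < \<eta>}"
    using assms
  proof (induction F)
    case empty
    then show ?case using openin_topspace[of weak_topology] by simp
  next
    case (insert f F)
    have "{y. \<forall>f\<in>insert f F. \<bar>blinfun_apply f (y - w)\<bar> < \<eta>} =
        blinfun_apply f -` ball (blinfun_apply f w) \<eta> \<inter> {y. \<forall>f\<in>F. \<bar>blinfun_apply f (y - w)\<bar> < \<eta>}"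
      by (auto simp: blinfun.diff_right dist_real_def abs_minus_commute)
    then show ?case using insert vim by (simp add: openin_Int)
  qed
  moreover have "weak_nbhd F w \<eta> = {y. \<forall>f\<in>F. \<bar>blinfun_apply f (y - w)\<bar> < \<eta>} \<inter> cball 0 1"
    by (auto simp: weak_nbhd_def)
  ultimately show ?thesis by (auto simp: openin_subtopology)
qed

text \<open>The centre \<open>w\<close> is prescribed, so that a neighbourhood can be recentred at any of its points.\<close>

lemma weak_nbhd_basis:
  fixes W :: "'a::real_normed_vector set"
  assumes W: "openin (subtopology weak_topology (cball 0 1)) W" and w: "w \<in> W"
  obtains F \<eta> where "finite F" "0 < \<eta>" "weak_nbhd F w \<eta> \<subseteq> W"
proof -
  obtain V where V: "openin weak_topology V" "W = V \<inter> cball 0 1"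
    using W by (auto simp: openin_subtopology)
  have "generate_topology_on {blinfun_apply f -` U | (f :: 'a \<Rightarrow>\<^sub>L real) U. open U} V"
    using V(1) by (simp add: weak_topology_def openin_topology_generated_by_iff)
  then have "w \<in> V \<Longrightarrow> \<exists>F \<eta>. finite F \<and> 0 < \<eta> \<and> weak_nbhd F w \<eta> \<subseteq> V"
  proof induction
    case Empty
    then show ?case by simp
  next
    case (Int a b)
    then obtain F \<eta> G \<delta> where "finite F" "0 < \<eta>" "weak_nbhd F w \<eta> \<subseteq> a"
      "finite G" "0 < \<delta>" "weak_nbhd G w \<delta> \<subseteq> b" by auto
    then show ?case
      by (intro exI[of _ "F \<union> G"] exI[of _ "min \<eta> \<delta>"]) (auto simp: weak_nbhd_def)
  next
    case (UN K)
    then obtain k where "k \<in> K" "w \<in> k" by auto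
    with UN.IH[of k] show ?case by (meson Union_upper order_trans)
  next
    case (Basis s)
    then obtain f :: "'a \<Rightarrow>\<^sub>L real" and U where f: "s = blinfun_apply f -` U" "open U" by blast
    then have "blinfun_apply f w \<in> U" using Basis by blast
    with f(2) obtain \<eta> where "0 < \<eta>" "ball (blinfun_apply f w) \<eta> \<subseteq> U"
      by (meson open_contains_ball)
    then show ?case
      by (intro exI[of _ "{f}"] exI[of _ \<eta>])
        (auto simp: weak_nbhd_def f blinfun.diff_right dist_real_def abs_minus_commute subset_iff)
  qed
  then obtain F \<eta> where "finite F" "0 < \<eta>" "weak_nbhd F w \<eta> \<subseteq> V" using w V by auto
  moreover have "weak_nbhd F w \<eta> \<subseteq> cball 0 1" by (auto simp: weak_nbhd_def)
  ultimately show ?thesis using that V by auto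
qed

lemma daugavet_thickness_le:
  fixes x :: "'a::real_normed_vector"
  assumes "0 < r" "norm x = 1" "finite F" "weak_nbhd F w \<eta> \<noteq> {}" "weak_nbhd F w \<eta> \<subseteq> cball x r"
  shows "daugavet_thickness TYPE('a) \<le> r"
  unfolding daugavet_thickness_def
proof (rule cInf_lower)
  show "r \<in> {r. r > 0 \<and> (\<exists>x \<in> sphere (0::'a) 1. \<exists>W.
      openin (subtopology weak_topology (cball 0 1)) W \<and> W \<noteq> {} \<and> W \<subseteq> cball x r)}"
    using assms openin_weak_nbhd[OF assms(3), of w \<eta>] by (auto intro!: bexI[of _ x])
qed (rule bdd_belowI[of _ 0], auto)

lemma daugavet_thickness_le_2:
  assumes "\<exists>x :: 'a::real_normed_vector. x \<noteq> 0"
  shows "daugavet_thickness TYPE('a) \<le> 2"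
proof -
  obtain x :: 'a where "x \<noteq> 0" using assms by auto
  then have n: "norm (sgn x) = 1" by (simp add: norm_sgn)
  show ?thesis
  proof (rule daugavet_thickness_le[of 2 "sgn x" "{}" 0 1])
    have "dist (sgn x) y \<le> 2" if "norm y \<le> 1" for y
      using norm_triangle_ineq4[of "sgn x" y] n that by (simp add: dist_norm)
    then show "weak_nbhd {} 0 1 \<subseteq> cball (sgn x) 2" by (auto simp: weak_nbhd_def)
    show "weak_nbhd {} 0 1 \<noteq> ({} :: 'a set)" by (auto simp: weak_nbhd_def intro!: exI[of _ 0])
  qed (use n in auto)
qed

text \<open>Spares later arguments the weak topology: lower bounds on the index need only be tested on
  basic neighbourhoods.\<close>

lemma daugavet_thickness_ge:
  assumes ne: "\<exists>x :: 'a::real_normed_vector. x \<noteq> 0"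
    and m: "\<And>r (x::'a) F w \<eta>. 0 < r \<Longrightarrow> norm x = 1 \<Longrightarrow> finite F \<Longrightarrow> 0 < \<eta> \<Longrightarrow> norm w \<le> 1 \<Longrightarrow>
              weak_nbhd F w \<eta> \<subseteq> cball x r \<Longrightarrow> m \<le> r"
  shows "m \<le> daugavet_thickness TYPE('a)"
  unfolding daugavet_thickness_def
proof (rule cInf_greatest)
  obtain x :: 'a where "x \<noteq> 0" using ne by auto
  then have n: "norm (sgn x) = 1" by (simp add: norm_sgn)
  have "dist (sgn x) y \<le> 2" if "norm y \<le> 1" for y
    using norm_triangle_ineq4[of "sgn x" y] n that by (simp add: dist_norm)
  moreover have "openin (subtopology weak_topology (cball 0 1)) (cball 0 1 :: 'a set)"
    by (simp add: openin_subtopology_refl)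
  ultimately have "\<exists>x \<in> sphere (0::'a) 1. \<exists>W.
      openin (subtopology weak_topology (cball 0 1)) W \<and> W \<noteq> {} \<and> W \<subseteq> cball x 2"
    using n by (intro bexI[of _ "sgn x"] exI[of _ "cball 0 1"]) auto
  then show "{r. r > 0 \<and> (\<exists>x \<in> sphere (0::'a) 1. \<exists>W.
      openin (subtopology weak_topology (cball 0 1)) W \<and> W \<noteq> {} \<and> W \<subseteq> cball x r)} \<noteq> {}"
    by (intro ex_in_conv[THEN iffD1] exI[of _ 2]) simp
next
  fix r assume "r \<in> {r. r > 0 \<and> (\<exists>x \<in> sphere (0::'a) 1. \<exists>W.
      openin (subtopology weak_topology (cball 0 1)) W \<and> W \<noteq> {} \<and> W \<subseteq> cball x r)}"
  then obtain x :: 'a and W w where r: "r > 0" "norm x = 1" "w \<in> W" "W \<subseteq> cball x r"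
    and W: "openin (subtopology weak_topology (cball 0 1)) W" by auto
  obtain F \<eta> where "finite F" "0 < \<eta>" "weak_nbhd F w \<eta> \<subseteq> W"
    using weak_nbhd_basis[OF W r(3)] .
  moreover have "norm w \<le> 1" using openin_subset[OF W] r(3) by auto
  ultimately show "m \<le> r" using m r by (meson order_trans)
qed


section \<open>Points of norm one in weak neighbourhoods\<close>

text \<open>A subspace on which finitely many functionals separate points is finite-dimensional, so the
  functionals control the norm. The subspace varies in the induction, where a functional is removed
  by passing to its kernel and splitting off one complementary vector.\<close>

lemma norm_bounded_by_separating_functionals:
  fixes F :: "('a::real_normed_vector \<Rightarrow>\<^sub>L real) set"
  assumes "finite F" "subspace S"
    and "\<And>y. y \<in> S \<Longrightarrow> \<forall>f\<in>F. blinfun_apply f y = 0 \<Longrightarrow> y = 0"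
  shows "\<exists>c\<ge>0. \<forall>y\<in>S. norm y \<le> c * (\<Sum>f\<in>F. \<bar>blinfun_apply f y\<bar>)"
  using assms
proof (induction F arbitrary: S)
  case empty
  then show ?case by (intro exI[of _ 0]) auto
next
  case (insert f F)
  let ?s = "\<lambda>y. \<Sum>h\<in>F. \<bar>blinfun_apply h y\<bar>"
  have s0: "0 \<le> ?s y" for y by (simp add: sum_nonneg)
  let ?T = "{y \<in> S. blinfun_apply f y = 0}"
  have "subspace ?T"
    using insert.prems(1) by (auto simp: subspace_def blinfun.bilinear_simps)
  then obtain c where c: "0 \<le> c" "\<And>y. y \<in> ?T \<Longrightarrow> norm y \<le> c * ?s y"
    using insert.IH[of ?T] insert.prems(2) by auto
  show ?case
  proof (cases "\<exists>e\<in>S. blinfun_apply f e \<noteq> 0")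
    case False
    have "norm y \<le> c * (\<Sum>h\<in>insert f F. \<bar>blinfun_apply h y\<bar>)" if "y \<in> S" for y
      using c(2)[of y] False that insert.hyps by auto
    then show ?thesis using c(1) by blast
  next
    case True
    then obtain e0 where e0: "e0 \<in> S" "blinfun_apply f e0 \<noteq> 0" by auto
    define e where "e = inverse (blinfun_apply f e0) *\<^sub>R e0"
    have e: "e \<in> S" "blinfun_apply f e = 1"
      using e0 insert.prems(1) by (auto simp: e_def subspace_scale blinfun.scaleR_right)
    define M where "M = c * ?s e + norm e"
    have M: "0 \<le> M" using c(1) s0 by (simp add: M_def)
    have "norm y \<le> (c + M) * (\<Sum>h\<in>insert f F. \<bar>blinfun_apply h y\<bar>)" if y: "y \<in> S" for y
    proof -
      let ?a = "blinfun_apply f y"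
      let ?y = "y - ?a *\<^sub>R e"
      have T: "?y \<in> ?T"
        using e y insert.prems(1)
        by (auto simp: subspace_diff subspace_scale blinfun.bilinear_simps)
      have "?s ?y \<le> (\<Sum>h\<in>F. \<bar>blinfun_apply h y\<bar> + \<bar>?a\<bar> * \<bar>blinfun_apply h e\<bar>)"
        by (rule sum_mono) (simp add: blinfun.bilinear_simps abs_mult[symmetric])
      also have "\<dots> = ?s y + \<bar>?a\<bar> * ?s e"
        by (simp add: sum.distrib sum_distrib_left)
      finally have "c * ?s ?y \<le> c * (?s y + \<bar>?a\<bar> * ?s e)"
        using c(1) by (rule mult_left_mono)
      moreover have "norm y \<le> norm ?y + \<bar>?a\<bar> * norm e"
        using norm_triangle_ineq[of ?y "?a *\<^sub>R e"] by simp
      ultimately have "norm y \<le> c * ?s y + \<bar>?a\<bar> * M"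
        using c(2)[OF T] by (simp add: M_def algebra_simps)
      also have "\<dots> \<le> (c + M) * (\<bar>?a\<bar> + ?s y)"
        using c(1) M s0[of y] by (simp add: algebra_simps)
      finally show ?thesis using insert.hyps by simp
    qed
    then show ?thesis using c(1) M by (intro exI[of _ "c + M"]) auto
  qed
qed

lemma line_meets_sphere:
  fixes w e :: "'a::real_normed_vector"
  assumes "norm w \<le> 1" "e \<noteq> 0"
  shows "\<exists>s. norm (w + s *\<^sub>R e) = 1"
proof -
  let ?b = "2 / norm e"
  have "\<exists>s\<ge>0. s \<le> ?b \<and> norm (w + s *\<^sub>R e) = 1"
  proof (rule IVT')
    have "norm (?b *\<^sub>R e) \<le> norm (w + ?b *\<^sub>R e) + norm w"
      using norm_triangle_ineq4[of "w + ?b *\<^sub>R e" w] by simp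
    then show "1 \<le> norm (w + ?b *\<^sub>R e)" using assms by simp
  qed (use assms in \<open>auto intro!: continuous_intros\<close>)
  then show ?thesis by blast
qed

text \<open>If the functionals have a common nonzero kernel vector, the centre can be moved along it to the
  sphere without leaving the neighbourhood. Otherwise the space is finite-dimensional, weak
  neighbourhoods of \<open>x\<close> itself are arbitrarily small, and the given neighbourhood is discarded.\<close>

lemma thin_weak_nbhd_on_sphere:
  fixes x :: "'a::real_normed_vector"
  assumes x: "norm x = 1" "0 < r" and F: "finite F" "0 < \<eta>" "norm w \<le> 1"
    and thin: "weak_nbhd F w \<eta> \<subseteq> cball x r"
  obtains G \<delta> y where "finite G" "0 < \<delta>" "norm y = 1" "weak_nbhd G y \<delta> \<subseteq> cball x r"
proof (cases "\<exists>e. e \<noteq> 0 \<and> (\<forall>f\<in>F. blinfun_apply f e = 0)")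
  case True
  then obtain e where e: "e \<noteq> 0" "\<forall>f\<in>F. blinfun_apply f e = 0" by blast
  obtain s where s: "norm (w + s *\<^sub>R e) = 1" using line_meets_sphere[OF F(3) e(1)] ..
  then have "w + s *\<^sub>R e \<in> weak_nbhd F w \<eta>"
    using e F by (simp add: weak_nbhd_def blinfun.bilinear_simps)
  from weak_nbhd_basis[OF openin_weak_nbhd[OF F(1)] this] obtain G \<delta> where
    "finite G" "0 < \<delta>" "weak_nbhd G (w + s *\<^sub>R e) \<delta> \<subseteq> weak_nbhd F w \<eta>" .
  with s thin that show thesis by blast
next
  case False
  then obtain c where c: "0 \<le> c" "\<And>y. norm y \<le> c * (\<Sum>f\<in>F. \<bar>blinfun_apply f y\<bar>)"
    using norm_bounded_by_separating_functionals[OF F(1) subspace_UNIV] by auto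
  define \<delta> where "\<delta> = r / (c * card F + 1)"
  have pos: "0 < c * card F + 1" using c(1) by (simp add: add_nonneg_pos)
  have \<delta>: "0 < \<delta>" using x(2) pos by (simp add: \<delta>_def)
  have "dist x y \<le> r" if "y \<in> weak_nbhd F x \<delta>" for y
  proof -
    have "(\<Sum>f\<in>F. \<bar>blinfun_apply f (y - x)\<bar>) \<le> (\<Sum>f\<in>F. \<delta>)"
      by (rule sum_mono) (use that in \<open>auto simp: weak_nbhd_def less_imp_le\<close>)
    then have "norm (y - x) \<le> c * (card F * \<delta>)"
      using c(2)[of "y - x"] mult_left_mono[OF _ c(1)] by (fastforce intro: order_trans)
    also have "\<dots> \<le> (c * card F + 1) * \<delta>" using \<delta> by (simp add: algebra_simps)
    also have "\<dots> = r" using pos by (simp add: \<delta>_def)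
    finally show ?thesis by (simp add: dist_norm norm_minus_commute)
  qed
  then have "weak_nbhd F x \<delta> \<subseteq> cball x r" by auto
  then show thesis using that[OF F(1) \<delta> x(1)] by blast
qed

section \<open>Slices and the Daugavet property\<close>

text \<open>Slices are measured from \<open>norm g\<close>, the supremum of \<open>g\<close> on the unit ball, so that
  every positive depth gives a nonempty slice; for \<open>g = 0\<close> the slice is the whole ball.\<close>

definition slice :: "('a::real_normed_vector \<Rightarrow>\<^sub>L real) \<Rightarrow> real \<Rightarrow> 'a set" where
  "slice g \<delta> = {u \<in> cball 0 1. norm g - \<delta> < blinfun_apply g u}"

lemma blinfun_almost_attains_norm:
  fixes T :: "'a::real_normed_vector \<Rightarrow>\<^sub>L 'b::real_normed_vector"
  assumes "0 < \<delta>"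
  obtains u where "norm u \<le> 1" "norm T - \<delta> < norm (blinfun_apply T u)"
proof (rule ccontr)
  assume "\<not> thesis"
  then have small: "norm (blinfun_apply T u) \<le> norm T - \<delta>" if "norm u \<le> 1" for u
    using that \<open>\<And>u. \<lbrakk>norm u \<le> 1; norm T - \<delta> < norm (blinfun_apply T u)\<rbrakk> \<Longrightarrow> thesis\<close> by force
  have c: "0 \<le> norm T - \<delta>" using small[of 0] by (simp add: blinfun.zero_right)
  have "norm (blinfun_apply T x) \<le> (norm T - \<delta>) * norm x" for x
  proof (cases "x = 0")
    case False
    have "norm (blinfun_apply T (sgn x)) \<le> norm T - \<delta>" by (rule small) (simp add: norm_sgn)
    then show ?thesis
      using False by (simp add: sgn_div_norm blinfun.scaleR_right field_simps)
  qed (simp add: blinfun.zero_right)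
  from norm_blinfun_bound[OF c this] show False using assms by simp
qed

lemma slice_nonempty:
  assumes "0 < \<delta>"
  shows "slice g \<delta> \<noteq> {}"
proof -
  obtain u where u: "norm u \<le> 1" "norm g - \<delta> < \<bar>blinfun_apply g u\<bar>"
    using blinfun_almost_attains_norm[OF assms, of g] by auto
  then have "u \<in> slice g \<delta> \<or> - u \<in> slice g \<delta>"
    by (auto simp: slice_def blinfun.minus_right abs_if split: if_splits)
  then show ?thesis by blast
qed

text \<open>A second difference of \<open>\<phi>\<close> is an increment of its slopes over adjacent intervals. The slopes are
  bounded by \<open>M\<close>, so among sufficiently many consecutive ones some increment is small.\<close>

lemma small_slope_increment:
  fixes \<phi> :: "real \<Rightarrow> real"
  assumes lip: "\<And>s t. \<bar>\<phi> s - \<phi> t\<bar> \<le> M * \<bar>s - t\<bar>" and \<eta>: "0 < \<eta>" and t0: "0 < t0"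
  obtains t h where "0 \<le> t" "t \<le> t0" "0 < h" "\<phi> (t + h) - 2 * \<phi> t + \<phi> (t - h) \<le> \<eta> * h"
proof -
  obtain N :: nat where N: "2 * M / \<eta> < N" using reals_Archimedean2 by blast
  have M: "0 \<le> M" using order_trans[OF abs_ge_zero lip[of 0 1]] by simp
  then have N0: "0 < N" using N \<eta> by (cases N) (auto simp: field_simps)
  define h where "h = t0 / N"
  have h: "0 < h" using t0 N0 by (simp add: h_def)
  define s where "s k = \<phi> (h * (real k + 1)) - \<phi> (h * real k)" for k
  have sM: "\<bar>s k\<bar> \<le> M * h" for k
    using lip[of "h * (real k + 1)" "h * real k"] h by (simp add: s_def algebra_simps)
  have "\<exists>k<N. s (Suc k) - s k \<le> \<eta> * h"
  proof (rule ccontr)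
    assume "\<not> ?thesis"
    then have "(\<Sum>k<N. \<eta> * h) \<le> (\<Sum>k<N. s (Suc k) - s k)"
      by (intro sum_mono) force
    also have "\<dots> = s N - s 0" by (rule sum_lessThan_telescope)
    also have "\<dots> \<le> 2 * M * h" using sM[of N] sM[of 0] by simp
    finally have "real N * \<eta> \<le> 2 * M" using h by (simp add: mult.assoc[symmetric])
    then show False using N \<eta> by (simp add: field_simps)
  qed
  then obtain k where k: "k < N" "s (Suc k) - s k \<le> \<eta> * h" by blast
  show thesis
  proof (rule that[of "h * (real k + 1)" h])
    have "h * (real k + 1) \<le> h * real N" using k h by (intro mult_left_mono) auto
    then show "h * (real k + 1) \<le> t0" using N0 by (simp add: h_def)
    show "\<phi> (h * (real k + 1) + h) - 2 * \<phi> (h * (real k + 1)) + \<phi> (h * (real k + 1) - h) \<le> \<eta> * h"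
      using k(2) by (simp add: s_def algebra_simps)
  qed (use h in auto)
qed

text \<open>The slice is tilted to \<open>g + t *\<^sub>R f\<close>. Comparing a point of a thin slice of this functional with
  the norms of \<open>g + (t + h) *\<^sub>R f\<close> and \<open>g + (t - h) *\<^sub>R f\<close> traps its value under \<open>f\<close> between two
  slopes of \<open>\<phi> t = norm (g + t *\<^sub>R f)\<close>. These almost agree for a suitable small \<open>t\<close>; this is a
  quantitative form of differentiability of \<open>\<phi>\<close>.\<close>

lemma slice_small_oscillation:
  fixes g f :: "'a::real_normed_vector \<Rightarrow>\<^sub>L real"
  assumes \<delta>: "0 < \<delta>" and \<eta>: "0 < \<eta>"
  obtains g' \<delta>' where "0 < \<delta>'" "slice g' \<delta>' \<subseteq> slice g \<delta>"
    "\<And>u v. u \<in> slice g' \<delta>' \<Longrightarrow> v \<in> slice g' \<delta>' \<Longrightarrow> \<bar>blinfun_apply f u - blinfun_apply f v\<bar> \<le> \<eta>"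
proof -
  define \<phi> where "\<phi> t = norm (g + t *\<^sub>R f)" for t
  define t0 where "t0 = \<delta> / (4 * (norm f + 1))"
  have f1: "0 < norm f + 1" by (simp add: add_nonneg_pos)
  have t0: "0 < t0" using \<delta> f1 by (simp add: t0_def)
  have t0f: "t0 * norm f \<le> \<delta> / 4"
    using \<delta> f1 by (simp add: t0_def field_simps)
  have "\<bar>\<phi> s - \<phi> t\<bar> \<le> norm f * \<bar>s - t\<bar>" for s t
    using norm_triangle_ineq3[of "g + s *\<^sub>R f" "g + t *\<^sub>R f"]
    by (simp add: \<phi>_def scaleR_left_diff_distrib[symmetric] mult.commute)
  from small_slope_increment[OF this, of "\<eta> / 2" t0] obtain t h where t: "0 \<le> t" "t \<le> t0"
    and h: "0 < h" and slope: "\<phi> (t + h) - 2 * \<phi> t + \<phi> (t - h) \<le> \<eta> / 2 * h"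
    using \<eta> t0 by auto
  define \<delta>' where "\<delta>' = min (\<delta> / 4) (\<eta> * h / 4)"
  have \<delta>': "0 < \<delta>'" "\<delta>' \<le> \<delta> / 4" "\<delta>' \<le> \<eta> * h / 4" using \<delta> \<eta> h by (auto simp: \<delta>'_def)
  let ?g = "g + t *\<^sub>R f"
  have le: "blinfun_apply g u + s * blinfun_apply f u \<le> \<phi> s" if "norm u \<le> 1" for u s
  proof -
    have "blinfun_apply (g + s *\<^sub>R f) u \<le> norm (g + s *\<^sub>R f) * norm u"
      using norm_blinfun[of "g + s *\<^sub>R f" u] by simp
    also have "\<dots> \<le> norm (g + s *\<^sub>R f) * 1"
      using that by (intro mult_left_mono) auto
    finally show ?thesis by (simp add: \<phi>_def blinfun.bilinear_simps)
  qed
  show thesis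
  proof (rule that[OF \<delta>'(1), of ?g])
    show "slice ?g \<delta>' \<subseteq> slice g \<delta>"
    proof
      fix u assume u: "u \<in> slice ?g \<delta>'"
      then have n: "norm u \<le> 1" and big: "\<phi> t - \<delta>' < blinfun_apply g u + t * blinfun_apply f u"
        by (auto simp: slice_def \<phi>_def blinfun.bilinear_simps)
      have "\<bar>blinfun_apply f u\<bar> \<le> norm f * norm u" using norm_blinfun[of f u] by simp
      also have "\<dots> \<le> norm f * 1" using n by (intro mult_left_mono) auto
      finally have "t * blinfun_apply f u \<le> t * norm f"
        using t by (intro mult_left_mono) auto
      moreover have "t * norm f \<le> \<delta> / 4"
        using mult_right_mono[OF t(2), of "norm f"] t0f by simp
      moreover have "norm g - t * norm f \<le> \<phi> t"
        using norm_triangle_ineq4[of ?g "t *\<^sub>R f"] t by (simp add: \<phi>_def)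
      ultimately have "norm g - \<delta> < blinfun_apply g u"
        using big \<delta>'(2) \<delta> by linarith
      then show "u \<in> slice g \<delta>" using n by (simp add: slice_def)
    qed
    fix u v assume uv: "u \<in> slice ?g \<delta>'" "v \<in> slice ?g \<delta>'"
    have osc: "h * (blinfun_apply f u - blinfun_apply f v) \<le> h * \<eta>"
      if uv: "u \<in> slice ?g \<delta>'" "v \<in> slice ?g \<delta>'" for u v
    proof -
      have "\<phi> t - \<delta>' < blinfun_apply g u + t * blinfun_apply f u" "norm u \<le> 1"
        "\<phi> t - \<delta>' < blinfun_apply g v + t * blinfun_apply f v" "norm v \<le> 1"
        using uv by (auto simp: slice_def \<phi>_def blinfun.bilinear_simps)
      with le[of u "t + h"] le[of v "t - h"] slope \<delta>'(3) show ?thesis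
        by (simp add: algebra_simps)
    qed
    then show "\<bar>blinfun_apply f u - blinfun_apply f v\<bar> \<le> \<eta>"
      using osc[OF uv] osc[OF uv(2) uv(1)] h by (simp add: abs_le_iff)
  qed
qed

lemma slice_small_oscillation_finite:
  fixes g :: "'a::real_normed_vector \<Rightarrow>\<^sub>L real" and F :: "('a \<Rightarrow>\<^sub>L real) set"
  assumes "finite F" and \<delta>: "0 < \<delta>" and \<eta>: "0 < \<eta>"
  shows "\<exists>g' \<delta>'. 0 < \<delta>' \<and> slice g' \<delta>' \<subseteq> slice g \<delta> \<and>
    (\<forall>f\<in>F. \<forall>u\<in>slice g' \<delta>'. \<forall>v\<in>slice g' \<delta>'. \<bar>blinfun_apply f u - blinfun_apply f v\<bar> \<le> \<eta>)"
  using assms(1)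
proof induction
  case empty
  then show ?case using \<delta> by auto
next
  case (insert f F)
  then obtain g1 \<delta>1 where 1: "0 < \<delta>1" "slice g1 \<delta>1 \<subseteq> slice g \<delta>"
    "\<forall>f\<in>F. \<forall>u\<in>slice g1 \<delta>1. \<forall>v\<in>slice g1 \<delta>1. \<bar>blinfun_apply f u - blinfun_apply f v\<bar> \<le> \<eta>"
    by blast
  obtain g2 \<delta>2 where "0 < \<delta>2" "slice g2 \<delta>2 \<subseteq> slice g1 \<delta>1"
    "\<And>u v. u \<in> slice g2 \<delta>2 \<Longrightarrow> v \<in> slice g2 \<delta>2 \<Longrightarrow> \<bar>blinfun_apply f u - blinfun_apply f v\<bar> \<le> \<eta>"
    using slice_small_oscillation[where g = g1 and f = f and \<delta> = \<delta>1 and \<eta> = \<eta>] 1(1) \<eta> by metis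
  with 1 show ?case by (intro exI[of _ g2] exI[of _ \<delta>2]) (auto simp: subset_iff)
qed

lemma daugavet_rank_one:
  fixes x :: "'a::real_normed_vector" and g :: "'a \<Rightarrow>\<^sub>L real"
  assumes D: "daugavet_property TYPE('a)" and "x \<noteq> 0" "norm g = 1" and \<epsilon>: "0 < \<epsilon>"
  obtains u where "norm u \<le> 1" "1 + norm x - \<epsilon> < norm (u - blinfun_apply g u *\<^sub>R x)"
proof -
  define R where "R = blinfun_scaleR_left (- x) o\<^sub>L g"
  have R: "blinfun_apply R u = - (blinfun_apply g u *\<^sub>R x)" for u
    by (simp add: R_def)
  obtain e where e: "blinfun_apply g e \<noteq> 0"
    using \<open>norm g = 1\<close> by (metis blinfun_eqI norm_zero zero_blinfun.rep_eq zero_neq_one)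
  have "range (blinfun_apply R) = span {x}"
  proof -
    have "c *\<^sub>R x \<in> range (blinfun_apply R)" for c
      by (rule range_eqI[of _ _ "(- c / blinfun_apply g e) *\<^sub>R e"])
        (use e in \<open>simp add: R blinfun.bilinear_simps\<close>)
    then show ?thesis
      by (auto simp: span_singleton R simp flip: scaleR_minus_left)
  qed
  then have "dim (range (blinfun_apply R)) = 1"
    using \<open>x \<noteq> 0\<close> dim_eq_card_independent[of "{x}"] by (simp add: dependent_single)
  then have nR: "norm (id_blinfun + R) = 1 + norm R"
    using D by (simp add: daugavet_property_def)
  have "norm g \<le> norm R / norm x"
  proof (rule norm_blinfun_bound)
    show "norm (blinfun_apply g u) \<le> norm R / norm x * norm u" for u
      using norm_blinfun[of R u] \<open>x \<noteq> 0\<close> by (simp add: R field_simps)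
  qed simp
  then have "norm x \<le> norm R" using \<open>x \<noteq> 0\<close> \<open>norm g = 1\<close> by (simp add: field_simps)
  moreover obtain u where "norm u \<le> 1" "norm (id_blinfun + R) - \<epsilon> < norm (blinfun_apply (id_blinfun + R) u)"
    using blinfun_almost_attains_norm[OF \<epsilon>] .
  ultimately show thesis
    using nR by (intro that[of u]) (auto simp: R blinfun.bilinear_simps)
qed

text \<open>A vector on which the identity minus the operator \<open>u \<mapsto> h u *\<^sub>R x\<close> almost attains its norm \<open>1 + norm x\<close> must
  have \<open>\<bar>h u\<bar>\<close> almost 1. Up to sign it lies in a given slice of \<open>h\<close>, and \<open>h u *\<^sub>R x\<close> is almost \<open>x\<close>.\<close>

lemma daugavet_slice:
  fixes x :: "'a::real_normed_vector"
  assumes D: "daugavet_property TYPE('a)" and x: "x \<noteq> 0" and \<delta>: "0 < \<delta>" and \<epsilon>: "0 < \<epsilon>"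
  obtains u where "u \<in> slice g \<delta>" "norm x + 1 - \<epsilon> \<le> norm (x - u)"
proof (cases "g = 0")
  case True
  have "x - - sgn x = (norm x + 1) *\<^sub>R sgn x"
    using x by (simp add: sgn_div_norm algebra_simps)
  then have "norm (x - - sgn x) = norm x + 1"
    using x by (simp add: norm_sgn)
  moreover have "- sgn x \<in> slice g \<delta>"
    using True \<delta> x by (simp add: slice_def norm_sgn)
  ultimately show thesis using that[of "- sgn x"] \<epsilon> by simp
next
  case False
  define \<gamma> where "\<gamma> = min (\<epsilon> / 2) (\<delta> * norm x / norm g)"
  have \<gamma>: "0 < \<gamma>" "\<gamma> \<le> \<epsilon> / 2" "\<gamma> \<le> \<delta> * norm x / norm g"
    using False x \<delta> \<epsilon> by (simp_all only: \<gamma>_def min.cobounded1 min.cobounded2) simp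
  define h where "h = g /\<^sub>R norm g"
  have h: "norm h = 1" using False by (simp add: h_def)
  obtain u0 where u0: "norm u0 \<le> 1" "1 + norm x - \<gamma> < norm (u0 - blinfun_apply h u0 *\<^sub>R x)"
    using daugavet_rank_one[OF D x h \<gamma>(1)] .
  define u where "u = (if blinfun_apply h u0 \<ge> 0 then u0 else - u0)"
  have "norm (- u0 + blinfun_apply h u0 *\<^sub>R x) = norm (u0 - blinfun_apply h u0 *\<^sub>R x)"
    using norm_minus_cancel[of "u0 - blinfun_apply h u0 *\<^sub>R x"] by simp
  with u0 have u: "norm u \<le> 1" "1 + norm x - \<gamma> < norm (u - blinfun_apply h u *\<^sub>R x)" 
    and hu: "0 \<le> blinfun_apply h u"
    by (auto simp: u_def blinfun.minus_right)
  have "blinfun_apply h u \<le> 1"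
    using norm_blinfun[of h u] u(1) h by simp
  have hux: "norm x - \<gamma> < blinfun_apply h u * norm x"
    using norm_triangle_ineq4[of u "blinfun_apply h u *\<^sub>R x"] u hu by simp
  have "norm g * (norm x - \<gamma>) < norm g * (blinfun_apply h u * norm x)"
    using hux False by simp
  also have "\<dots> = blinfun_apply g u * norm x"
    using False by (simp add: h_def blinfun.bilinear_simps)
  finally have "norm g * norm x - norm g * \<gamma> < blinfun_apply g u * norm x"
    by (simp add: algebra_simps)
  moreover have "norm g * \<gamma> \<le> \<delta> * norm x"
    using \<gamma>(3) False by (simp add: field_simps)
  ultimately have "(norm g - \<delta>) * norm x < blinfun_apply g u * norm x"
    by (simp add: algebra_simps)
  then have "u \<in> slice g \<delta>" using x u(1) by (simp add: slice_def)
  moreover have "norm x + 1 - \<epsilon> \<le> norm (x - u)"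
  proof -
    have "u - blinfun_apply h u *\<^sub>R x = (1 - blinfun_apply h u) *\<^sub>R x - (x - u)"
      by (simp add: algebra_simps)
    then have "norm (u - blinfun_apply h u *\<^sub>R x) \<le> (1 - blinfun_apply h u) * norm x + norm (x - u)"
      using norm_triangle_ineq4[of "(1 - blinfun_apply h u) *\<^sub>R x" "x - u"] \<open>blinfun_apply h u \<le> 1\<close>
      by (simp only: norm_scaleR)
    then show ?thesis using u(2) hux \<gamma>(2) by (simp add: algebra_simps)
  qed
  ultimately show thesis using that by blast
qed

lemma norm_diff_scaled_ge:
  fixes x u :: "'a::real_normed_vector"
  assumes a: "0 < a" and far: "norm (x /\<^sub>R a) + 1 - \<epsilon> \<le> norm (x /\<^sub>R a - u)"
  shows "norm x + a * (1 - \<epsilon>) \<le> norm (x - a *\<^sub>R u)"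
proof -
  have "norm x + a * (1 - \<epsilon>) = a * (norm (x /\<^sub>R a) + 1 - \<epsilon>)"
    using a by (simp add: distrib_left right_diff_distrib)
  also have "\<dots> \<le> a * norm (x /\<^sub>R a - u)"
    using far a by (intro mult_left_mono) auto
  also have "\<dots> = norm (a *\<^sub>R (x /\<^sub>R a - u))" using a by simp
  also have "a *\<^sub>R (x /\<^sub>R a - u) = x - a *\<^sub>R u"
    using a by (simp add: scaleR_right_diff_distrib)
  finally show ?thesis .
qed

text \<open>The vector \<open>x\<close> has arbitrary nonzero norm, and not norm one, because convexity of this set
  uses the condition for rescaled vectors.\<close>

definition everywhere_far :: "('a::real_normed_vector \<Rightarrow>\<^sub>L real) set \<Rightarrow> real \<Rightarrow> 'a set" where
  "everywhere_far F \<eta> = {v \<in> cball 0 1. \<forall>x \<epsilon>. x \<noteq> 0 \<longrightarrow> 0 < \<epsilon> \<longrightarrow> \<epsilon> < 1 \<longrightarrow>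
     (\<exists>u \<in> weak_nbhd F v \<eta>. norm x + 1 - \<epsilon> \<le> norm (x - u))}"

text \<open>For a combination with weights \<open>1 - c\<close> and \<open>c\<close>, first choose \<open>u1\<close> far from \<open>x /\<^sub>R (1 - c)\<close> and then
  \<open>u2\<close> far from the rescaled remainder \<open>(x - (1 - c) *\<^sub>R u1) /\<^sub>R c\<close>. The gains \<open>(1 - c) * (1 - \<epsilon>)\<close> and
  \<open>c * (1 - \<epsilon>)\<close> add up.\<close>

lemma convex_everywhere_far: "convex (everywhere_far F \<eta>)"
  unfolding convex_alt
proof (intro ballI allI impI)
  fix v1 v2 and c :: real
  assume v: "v1 \<in> everywhere_far F \<eta>" "v2 \<in> everywhere_far F \<eta>" and "0 \<le> c \<and> c \<le> 1"
  then consider "c = 0" | "c = 1" | "0 < c" "c < 1" by linarith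
  then show "(1 - c) *\<^sub>R v1 + c *\<^sub>R v2 \<in> everywhere_far F \<eta>" (is "?v \<in> _")
  proof cases
    case 3
    have v1: "norm v1 \<le> 1" "\<And>x \<epsilon>. x \<noteq> 0 \<Longrightarrow> 0 < \<epsilon> \<Longrightarrow> \<epsilon> < 1 \<Longrightarrow>
        \<exists>u \<in> weak_nbhd F v1 \<eta>. norm x + 1 - \<epsilon> \<le> norm (x - u)"
      and v2: "norm v2 \<le> 1" "\<And>x \<epsilon>. x \<noteq> 0 \<Longrightarrow> 0 < \<epsilon> \<Longrightarrow> \<epsilon> < 1 \<Longrightarrow>
        \<exists>u \<in> weak_nbhd F v2 \<eta>. norm x + 1 - \<epsilon> \<le> norm (x - u)"
      using v by (auto simp: everywhere_far_def)
    have ball: "norm ((1 - c) *\<^sub>R a + c *\<^sub>R b) \<le> 1" if "norm a \<le> 1" "norm b \<le> 1" for a b :: 'a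
      using convexD_alt[OF convex_cball, of a "0::'a" 1 b c] that 3 by simp
    have "\<exists>u \<in> weak_nbhd F ?v \<eta>. norm x + 1 - \<epsilon> \<le> norm (x - u)"
      if x: "x \<noteq> 0" and \<epsilon>: "0 < \<epsilon>" "\<epsilon> < 1" for x \<epsilon>
    proof -
      obtain u1 where u1: "u1 \<in> weak_nbhd F v1 \<eta>"
        "norm (x /\<^sub>R (1 - c)) + 1 - \<epsilon> \<le> norm (x /\<^sub>R (1 - c) - u1)"
        using v1(2)[of "x /\<^sub>R (1 - c)" \<epsilon>] x \<epsilon> 3 by auto
      define x' where "x' = x - (1 - c) *\<^sub>R u1"
      have x': "norm x + (1 - c) * (1 - \<epsilon>) \<le> norm x'"
        unfolding x'_def using 3 u1(2) by (intro norm_diff_scaled_ge) auto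
      have "0 < (1 - c) * (1 - \<epsilon>)" using 3 \<epsilon> by simp
      with x' have "x' \<noteq> 0" using norm_ge_zero[of x] by force
      then obtain u2 where u2: "u2 \<in> weak_nbhd F v2 \<eta>"
        "norm (x' /\<^sub>R c) + 1 - \<epsilon> \<le> norm (x' /\<^sub>R c - u2)"
        using v2(2)[of "x' /\<^sub>R c" \<epsilon>] \<epsilon> 3 by auto
      let ?u = "(1 - c) *\<^sub>R u1 + c *\<^sub>R u2"
      have "norm x' + c * (1 - \<epsilon>) \<le> norm (x' - c *\<^sub>R u2)"
        using 3 u2(2) by (intro norm_diff_scaled_ge) auto
      moreover have "x' - c *\<^sub>R u2 = x - ?u" by (simp add: x'_def)
      ultimately have "norm x + 1 - \<epsilon> \<le> norm (x - ?u)"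
        using x' by (simp add: algebra_simps)
      moreover have "?u \<in> weak_nbhd F ?v \<eta>"
      proof -
        have "\<bar>blinfun_apply f (?u - ?v)\<bar> < \<eta>" if "f \<in> F" for f
        proof -
          have "?u - ?v = (1 - c) *\<^sub>R (u1 - v1) + c *\<^sub>R (u2 - v2)"
            by (simp add: algebra_simps)
          then have "\<bar>blinfun_apply f (?u - ?v)\<bar> \<le>
              (1 - c) * \<bar>blinfun_apply f (u1 - v1)\<bar> + c * \<bar>blinfun_apply f (u2 - v2)\<bar>"
            using 3 abs_triangle_ineq[of "(1 - c) * blinfun_apply f (u1 - v1)" "c * blinfun_apply f (u2 - v2)"]
            by (simp only: blinfun.add_right blinfun.scaleR_right abs_mult real_scaleR_def abs_of_pos diff_gt_0_iff_gt)
          also have "\<dots> < (1 - c) * \<eta> + c * \<eta>"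
            using u1(1) u2(1) that 3
            by (intro add_strict_mono mult_strict_left_mono) (auto simp: weak_nbhd_def)
          finally show ?thesis by (simp add: algebra_simps)
        qed
        moreover have "norm ?u \<le> 1" using ball u1(1) u2(1) by (auto simp: weak_nbhd_def)
        ultimately show ?thesis by (simp add: weak_nbhd_def)
      qed
      ultimately show ?thesis by blast
    qed
    then show ?thesis using ball[OF v1(1) v2(1)] by (auto simp: everywhere_far_def)
  qed (use v in simp_all)
qed

text \<open>Each point of a slice with small oscillation belongs to the set, since the far points of that
  slice are weakly close to it.\<close>

lemma slice_meets_everywhere_far:
  fixes g :: "'a::real_normed_vector \<Rightarrow>\<^sub>L real"
  assumes D: "daugavet_property TYPE('a)" and F: "finite F" and "0 < \<delta>" "0 < \<eta>"
  shows "slice g \<delta> \<inter> everywhere_far F \<eta> \<noteq> {}"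
proof -
  obtain g' \<delta>' where g': "0 < \<delta>'" "slice g' \<delta>' \<subseteq> slice g \<delta>" and osc:
    "\<And>f u v. f \<in> F \<Longrightarrow> u \<in> slice g' \<delta>' \<Longrightarrow> v \<in> slice g' \<delta>' \<Longrightarrow>
       \<bar>blinfun_apply f u - blinfun_apply f v\<bar> \<le> \<eta> / 2"
    using slice_small_oscillation_finite[OF F, of \<delta> "\<eta> / 2" g] assms by auto
  obtain v where v: "v \<in> slice g' \<delta>'" using slice_nonempty[OF g'(1)] by blast
  have "\<exists>u \<in> weak_nbhd F v \<eta>. norm x + 1 - \<epsilon> \<le> norm (x - u)" if x: "x \<noteq> 0" and \<epsilon>: "0 < \<epsilon>" for x \<epsilon>
  proof -
    obtain u where u: "u \<in> slice g' \<delta>'" "norm x + 1 - \<epsilon> \<le> norm (x - u)"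
      using daugavet_slice[OF D x g'(1) \<epsilon>] .
    have "u \<in> weak_nbhd F v \<eta>"
      using osc[OF _ u(1) v] u(1) \<open>0 < \<eta>\<close>
      by (force simp: weak_nbhd_def slice_def blinfun.diff_right)
    with u show ?thesis by blast
  qed
  then have "v \<in> everywhere_far F \<eta>" using v by (auto simp: everywhere_far_def slice_def)
  then show ?thesis using v g'(2) by blast
qed

text \<open>Otherwise a functional \<open>f\<close> of norm at most one separates \<open>w\<close> from the convex set by \<open>\<rho>\<close>, and
  the slice of \<open>f\<close> of depth \<open>\<rho>\<close> misses the set.\<close>

lemma everywhere_far_dense:
  fixes w :: "'a::real_normed_vector"
  assumes D: "daugavet_property TYPE('a)" and F: "finite F" and "0 < \<eta>" "0 < \<rho>" "norm w \<le> 1"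
  obtains v where "v \<in> everywhere_far F \<eta>" "norm (v - w) < \<rho>"
proof (rule ccontr)
  assume "\<not> thesis"
  then have far: "\<rho> \<le> norm (w - v)" if "v \<in> everywhere_far F \<eta>" for v
    using \<open>\<And>v. \<lbrakk>v \<in> everywhere_far F \<eta>; norm (v - w) < \<rho>\<rbrakk> \<Longrightarrow> thesis\<close> that
    by (force simp: norm_minus_commute)
  let ?D = "(\<lambda>v. w - v) ` everywhere_far F \<eta>"
  have "convex ?D"
    using convex_translation[OF convex_negations[OF convex_everywhere_far[of F \<eta>]], of w]
    by (simp add: image_image)
  moreover have "?D \<noteq> {}"
    using slice_meets_everywhere_far[OF D F zero_less_one \<open>0 < \<eta>\<close>] by blast
  ultimately obtain f :: "'a \<Rightarrow>\<^sub>L real"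
    where f: "\<And>v. v \<in> everywhere_far F \<eta> \<Longrightarrow> \<rho> \<le> blinfun_apply f (w - v)"
    using separate_convex_from_origin[of ?D \<rho>] far by auto
  obtain v where v: "v \<in> slice f \<rho>" "v \<in> everywhere_far F \<eta>"
    using slice_meets_everywhere_far[OF D F \<open>0 < \<rho>\<close> \<open>0 < \<eta>\<close>, of f] by blast
  have "blinfun_apply f w \<le> norm f * norm w" using norm_blinfun[of f w] by simp
  also have "\<dots> \<le> norm f * 1" using \<open>norm w \<le> 1\<close> by (intro mult_left_mono) auto
  finally show False using f[OF v(2)] v(1) by (simp add: slice_def blinfun.diff_right)
qed

lemma daugavet_weak_nbhd:
  fixes w x :: "'a::real_normed_vector"
  assumes D: "daugavet_property TYPE('a)" and F: "finite F" and \<eta>: "0 < \<eta>" and w: "norm w \<le> 1"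
    and ne: "\<exists>e :: 'a. e \<noteq> 0" and \<epsilon>: "0 < \<epsilon>"
  obtains u where "u \<in> weak_nbhd F w \<eta>" "norm x + 1 - \<epsilon> \<le> norm (x - u)"
proof -
  define C where "C = (\<Sum>f\<in>F. norm f) + 1"
  have C: "0 < C" unfolding C_def by (intro add_nonneg_pos sum_nonneg) auto
  obtain v where v: "v \<in> everywhere_far F (\<eta> / 2)" "norm (v - w) < \<eta> / (2 * C)"
    using everywhere_far_dense[OF D F, of "\<eta> / 2" "\<eta> / (2 * C)" w] \<eta> C w by auto
  have sub: "weak_nbhd F v (\<eta> / 2) \<subseteq> weak_nbhd F w \<eta>"
  proof -
    have "\<bar>blinfun_apply f (u - w)\<bar> < \<eta>" if f: "f \<in> F" and fu: "\<bar>blinfun_apply f (u - v)\<bar> < \<eta> / 2" for f u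
    proof -
      have "\<bar>blinfun_apply f (v - w)\<bar> \<le> norm f * norm (v - w)" using norm_blinfun[of f "v - w"] by simp
      also have "\<dots> \<le> C * norm (v - w)"
        using member_le_sum[OF f, of norm] F by (intro mult_right_mono) (auto simp: C_def)
      also have "\<dots> \<le> \<eta> / 2" using v(2) C by (simp add: field_simps)
      finally show ?thesis using fu by (auto simp: blinfun.diff_right abs_if split: if_splits)
    qed
    then show ?thesis by (auto simp: weak_nbhd_def)
  qed
  have far: "\<exists>u \<in> weak_nbhd F w \<eta>. norm z + 1 - \<epsilon> \<le> norm (z - u)" if z: "z \<noteq> 0" for z
  proof -
    have "\<exists>u \<in> weak_nbhd F v (\<eta> / 2). norm z + 1 - min \<epsilon> (1/2) \<le> norm (z - u)"
      using v(1) z \<epsilon> unfolding everywhere_far_def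
      by (auto dest!: spec[of _ z] spec[of _ "min \<epsilon> (1/2)"])
    then show ?thesis using sub by force
  qed
  show thesis
  proof (cases "x = 0")
    case False
    then show ?thesis using far[of x] that by blast
  next
    case True
    obtain e :: 'a where "e \<noteq> 0" using ne by blast
    then obtain u where u: "u \<in> weak_nbhd F w \<eta>" "norm e + 1 - \<epsilon> \<le> norm (e - u)" using far by blast
    then have "1 - \<epsilon> \<le> norm u" using norm_triangle_ineq4[of e u] by linarith
    then show ?thesis using that[OF u(1)] True by simp
  qed
qed

section \<open>The thickness index of an l1-sum\<close>

text \<open>The abstract form of an l1-sum, with embeddings \<open>i\<close>, \<open>j\<close> and projections \<open>p\<close>, \<open>q\<close>. It is
  symmetric in the summands, so each estimate is proved for one of them only.\<close>

locale l1_decomposition =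
  fixes i :: "'x::real_normed_vector \<Rightarrow>\<^sub>L 'z::real_normed_vector"
    and j :: "'y::real_normed_vector \<Rightarrow>\<^sub>L 'z"
    and p :: "'z \<Rightarrow>\<^sub>L 'x" and q :: "'z \<Rightarrow>\<^sub>L 'y"
  assumes p_i [simp]: "blinfun_apply p (blinfun_apply i x) = x"
    and q_i [simp]: "blinfun_apply q (blinfun_apply i x) = 0"
    and p_j [simp]: "blinfun_apply p (blinfun_apply j y) = 0"
    and q_j [simp]: "blinfun_apply q (blinfun_apply j y) = y"
    and norm_split: "norm z = norm (blinfun_apply p z) + norm (blinfun_apply q z)"
begin

lemma swap: "l1_decomposition j i q p"
  by unfold_locales (use norm_split in auto)

lemma decomp: "blinfun_apply i (blinfun_apply p z) + blinfun_apply j (blinfun_apply q z) = z"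
proof -
  have "norm (z - (blinfun_apply i (blinfun_apply p z) + blinfun_apply j (blinfun_apply q z))) = 0"
    by (subst norm_split) (simp add: blinfun.bilinear_simps)
  then show ?thesis by simp
qed

lemma thickness_le_left:
  assumes "\<exists>x :: 'x. x \<noteq> 0"
  shows "daugavet_thickness TYPE('z) \<le> daugavet_thickness TYPE('x)"
proof (rule daugavet_thickness_ge[OF assms])
  fix r :: real and x w :: 'x and F \<eta>
  assume r: "0 < r" "norm x = 1" "finite F" "0 < \<eta>" "norm w \<le> 1" "weak_nbhd F w \<eta> \<subseteq> cball x r"
  obtain G \<delta> y where G: "finite G" "0 < \<delta>" "norm y = 1" "weak_nbhd G y \<delta> \<subseteq> cball x r"
    using thin_weak_nbhd_on_sphere[OF r(2,1,3-6)] .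
  obtain g :: "'x \<Rightarrow>\<^sub>L real" where g: "norm g \<le> 1" "1 \<le> blinfun_apply g y"
    using separate_convex_from_origin[of "{y}" 1] G(3) by auto
  show "daugavet_thickness TYPE('z) \<le> r"
  proof (rule field_le_epsilon)
    fix e :: real assume e: "0 < e"
    (* the functional g forces the first component to have norm at least 1 - e *)
    let ?H = "(\<lambda>f. f o\<^sub>L p) ` insert g G"
    let ?W = "weak_nbhd ?H (blinfun_apply i y) (min \<delta> e)"
    have n: "norm (blinfun_apply i v) = norm v" for v by (subst norm_split) simp
    show "daugavet_thickness TYPE('z) \<le> r + e"
    proof (rule daugavet_thickness_le)
      show "0 < r + e" using r e by simp
      show "norm (blinfun_apply i x) = 1" using n r by simp
      show "finite ?H" using G by simp
      show "?W \<noteq> {}"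
        using G e n by (auto simp: weak_nbhd_def blinfun.bilinear_simps intro!: exI[of _ "blinfun_apply i y"])
      show "?W \<subseteq> cball (blinfun_apply i x) (r + e)"
      proof
        fix z assume z: "z \<in> ?W"
        have zn: "norm (blinfun_apply p z) + norm (blinfun_apply q z) \<le> 1"
          using z norm_split[of z] by (simp add: weak_nbhd_def)
        then have pz: "norm (blinfun_apply p z) \<le> 1" using norm_ge_zero[of "blinfun_apply q z"] by linarith
        have "blinfun_apply p z \<in> weak_nbhd G y \<delta>"
          using z pz by (auto simp: weak_nbhd_def blinfun.diff_right)
        then have 1: "norm (x - blinfun_apply p z) \<le> r" using G(4) by (auto simp: dist_norm)
        have "\<bar>blinfun_apply g (blinfun_apply p z) - blinfun_apply g y\<bar> < e"
          using z by (auto simp: weak_nbhd_def blinfun.diff_right)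
        moreover have "blinfun_apply g (blinfun_apply p z) \<le> 1 * norm (blinfun_apply p z)"
          using norm_blinfun[of g "blinfun_apply p z"] mult_right_mono[OF g(1) norm_ge_zero[of "blinfun_apply p z"]]
          by simp
        ultimately have "norm (blinfun_apply q z) \<le> e" using g(2) zn by linarith
        then show "z \<in> cball (blinfun_apply i x) (r + e)"
          using 1 norm_split[of "blinfun_apply i x - z"] by (simp add: dist_norm blinfun.diff_right)
      qed
    qed
  qed
qed

lemma thickness_ge_right:
  assumes D: "daugavet_property TYPE('x)" and nx: "\<exists>x :: 'x. x \<noteq> 0" and ny: "\<exists>y :: 'y. y \<noteq> 0"
  shows "daugavet_thickness TYPE('y) \<le> daugavet_thickness TYPE('z)"
proof (rule daugavet_thickness_ge)
  show "\<exists>z :: 'z. z \<noteq> 0" 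
  proof -
    obtain x :: 'x where "x \<noteq> 0" using nx by blast
    then have "blinfun_apply i x \<noteq> 0" by (metis p_i blinfun.zero_right)
    then show ?thesis by blast
  qed
  fix r :: real and z w :: 'z and F \<eta>
  assume r: "0 < r" "norm z = 1" "finite F" "0 < \<eta>" "norm w \<le> 1" "weak_nbhd F w \<eta> \<subseteq> cball z r"
  let ?T = "daugavet_thickness TYPE('y)"
  define x0 where "x0 = blinfun_apply p z" define y0 where "y0 = blinfun_apply q z"
  define u where "u = blinfun_apply p w" define v where "v = blinfun_apply q w"
  have xy0: "norm x0 + norm y0 = 1" using r norm_split[of z] by (simp add: x0_def y0_def)
  have uv: "norm u + norm v \<le> 1" using r norm_split[of w] by (simp add: u_def v_def)
  then have u1: "norm u \<le> 1" using norm_ge_zero[of v] by linarith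
  have T2: "?T \<le> 2" by (rule daugavet_thickness_le_2[OF ny])
  show "?T \<le> r"
  proof (rule field_le_epsilon)
    fix e :: real assume "0 < e"
    define \<epsilon> where "\<epsilon> = e / 2"
    have \<epsilon>: "0 < \<epsilon>" using \<open>0 < e\<close> by (simp add: \<epsilon>_def)
    let ?Fi = "(\<lambda>f. f o\<^sub>L i) ` F" let ?Fj = "(\<lambda>f. f o\<^sub>L j) ` F"
    have "\<exists>x. norm x \<le> norm u \<and> (\<forall>f\<in>F. \<bar>blinfun_apply f (blinfun_apply i (x - u))\<bar> < \<eta> / 2) \<and>
        norm x0 + norm u - \<epsilon> \<le> norm (x0 - x)"
    proof (cases "u = 0")
      case True
      then show ?thesis using r \<epsilon> by (intro exI[of _ 0]) (simp add: blinfun.zero_right)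
    next
      case False
      let ?a = "norm u"
      have a: "0 < ?a" using False by simp
      obtain u' where u': "u' \<in> weak_nbhd ?Fi (u /\<^sub>R ?a) (\<eta> / (2 * ?a))"
        "norm (x0 /\<^sub>R ?a) + 1 - \<epsilon> \<le> norm (x0 /\<^sub>R ?a - u')"
        using daugavet_weak_nbhd[OF D _ _ _ nx \<epsilon>, of ?Fi "\<eta> / (2 * ?a)" "u /\<^sub>R ?a" "x0 /\<^sub>R ?a"] r a
        by auto
      have eq: "?a *\<^sub>R u' - u = ?a *\<^sub>R (u' - u /\<^sub>R ?a)"
        using a by (simp add: scaleR_right_diff_distrib)
      have "\<bar>blinfun_apply f (blinfun_apply i (?a *\<^sub>R u' - u))\<bar> < \<eta> / 2" if "f \<in> F" for f
      proof -
        have "\<bar>blinfun_apply f (blinfun_apply i (u' - u /\<^sub>R ?a))\<bar> < \<eta> / (2 * ?a)"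
          using u'(1) that by (auto simp: weak_nbhd_def)
        then show ?thesis unfolding eq blinfun.scaleR_right using a by (simp add: abs_mult field_simps)
      qed
      moreover have "norm (?a *\<^sub>R u') \<le> ?a"
        using u'(1) a by (simp add: weak_nbhd_def)
      moreover have "norm x0 + ?a - \<epsilon> \<le> norm (x0 - ?a *\<^sub>R u')"
      proof -
        have "?a * \<epsilon> \<le> \<epsilon>" using u1 \<epsilon> by (simp add: mult_left_le_one_le)
        then show ?thesis using norm_diff_scaled_ge[OF a u'(2)] by (simp add: algebra_simps)
      qed
      ultimately show ?thesis by blast
    qed
    then obtain x where x: "norm x \<le> norm u"
      "\<And>f. f \<in> F \<Longrightarrow> \<bar>blinfun_apply f (blinfun_apply i (x - u))\<bar> < \<eta> / 2"
      "norm x0 + norm u - \<epsilon> \<le> norm (x0 - x)" by blast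
    have "\<exists>y. norm y \<le> 1 - norm u \<and> (\<forall>f\<in>F. \<bar>blinfun_apply f (blinfun_apply j (y - v))\<bar> < \<eta> / 2) \<and>
        ?T - \<epsilon> - (1 - norm y0) - norm u \<le> norm (y0 - y)"
    proof (cases "?T - \<epsilon> \<le> 0 \<or> norm u = 1")
      case True
      have "?T - \<epsilon> - (1 - norm y0) - norm u \<le> norm (y0 - v)"
      proof (cases "norm u = 1")
        case True
        then have "v = 0" using uv by simp
        then show ?thesis using True T2 \<epsilon> by simp
      next
        case False
        then have "?T - \<epsilon> \<le> 0" using \<open>?T - \<epsilon> \<le> 0 \<or> norm u = 1\<close> by simp
        moreover have "norm y0 \<le> 1" using xy0 norm_ge_zero[of x0] by linarith
        ultimately show ?thesis
          using norm_ge_zero[of "y0 - v"] norm_ge_zero[of u] by linarith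
      qed
      then show ?thesis using uv r by (intro exI[of _ v]) (auto simp: blinfun.zero_right)
    next
      case False
      (* This radius, at least norm v, is the largest that keeps the sum of the components in the
         unit ball; shrinking y' to it costs at most norm u in distance. *)
      define t where "t = 1 - norm u"
      have t: "0 < t" "t \<le> 1" "norm v \<le> t" using False u1 uv by (auto simp: t_def)
      obtain e0 :: 'y where "e0 \<noteq> 0" using ny by blast
      define e1 where "e1 = (if y0 = 0 then sgn e0 else sgn y0)"
      have e1: "norm e1 = 1" "y0 = norm y0 *\<^sub>R e1"
        using \<open>e0 \<noteq> 0\<close> by (auto simp: e1_def norm_sgn sgn_div_norm)
      let ?V = "weak_nbhd ?Fj (v /\<^sub>R t) (\<eta> / (2 * t))"
      have "v /\<^sub>R t \<in> ?V" using t r by (simp add: weak_nbhd_def blinfun.zero_right field_simps)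
      then have "\<not> ?V \<subseteq> cball e1 (?T - \<epsilon>)"
        using daugavet_thickness_le[of "?T - \<epsilon>" e1 ?Fj "v /\<^sub>R t" "\<eta> / (2 * t)"] False e1(1) r \<epsilon> by auto
      then obtain y' where "y' \<in> ?V" "y' \<notin> cball e1 (?T - \<epsilon>)" by blast
      then have y': "y' \<in> ?V" "?T - \<epsilon> < norm (e1 - y')" by (simp_all add: dist_norm)
      have eq: "t *\<^sub>R y' - v = t *\<^sub>R (y' - v /\<^sub>R t)"
        using t by (simp add: scaleR_right_diff_distrib)
      have "\<bar>blinfun_apply f (blinfun_apply j (t *\<^sub>R y' - v))\<bar> < \<eta> / 2" if "f \<in> F" for f
      proof -
        have "\<bar>blinfun_apply f (blinfun_apply j (y' - v /\<^sub>R t))\<bar> < \<eta> / (2 * t)"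
          using y'(1) that by (auto simp: weak_nbhd_def)
        then show ?thesis unfolding eq blinfun.scaleR_right using t by (simp add: abs_mult field_simps)
      qed
      moreover have y'1: "norm y' \<le> 1" using y'(1) by (simp add: weak_nbhd_def)
      then have "norm (t *\<^sub>R y') \<le> t" using t by simp
      moreover have "?T - \<epsilon> - (1 - norm y0) - norm u \<le> norm (y0 - t *\<^sub>R y')"
      proof -
        have "norm (e1 - y0) = 1 - norm y0"
        proof -
          have "norm y0 \<le> 1" using xy0 norm_ge_zero[of x0] by linarith
          moreover have "e1 - y0 = (1 - norm y0) *\<^sub>R e1"
            using e1(2) by (simp add: scaleR_left_diff_distrib)
          ultimately show ?thesis using e1(1) by simp
        qed
        moreover have "norm (t *\<^sub>R y' - y') \<le> norm u"
        proof -
          have "t *\<^sub>R y' - y' = - (norm u *\<^sub>R y')" by (simp add: t_def algebra_simps)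
          then show ?thesis using y'1 by (simp add: mult_left_le)
        qed
        moreover have "norm (e1 - y') \<le> norm (e1 - y0) + norm (y0 - t *\<^sub>R y') + norm (t *\<^sub>R y' - y')"
          using norm_triangle_ineq[of "e1 - y0" "y0 - y'"]
            norm_triangle_ineq[of "y0 - t *\<^sub>R y'" "t *\<^sub>R y' - y'"] by simp
        ultimately show ?thesis using y'(2) by linarith
      qed
      ultimately show ?thesis unfolding t_def by blast
    qed
    then obtain y where y: "norm y \<le> 1 - norm u"
      "\<And>f. f \<in> F \<Longrightarrow> \<bar>blinfun_apply f (blinfun_apply j (y - v))\<bar> < \<eta> / 2"
      "?T - \<epsilon> - (1 - norm y0) - norm u \<le> norm (y0 - y)" by blast
    let ?z = "blinfun_apply i x + blinfun_apply j y"
    have "norm ?z \<le> 1"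
      using x(1) y(1) norm_split[of ?z] by (simp add: blinfun.bilinear_simps)
    moreover have "\<bar>blinfun_apply f (?z - w)\<bar> < \<eta>" if "f \<in> F" for f
    proof -
      have "?z - w = blinfun_apply i (x - u) + blinfun_apply j (y - v)"
        using decomp[of w] by (simp add: u_def v_def blinfun.diff_right algebra_simps)
      then show ?thesis using x(2)[OF that] y(2)[OF that] by (simp only: blinfun.add_right)
    qed
    ultimately have "?z \<in> weak_nbhd F w \<eta>" by (simp add: weak_nbhd_def)
    then have "norm (z - ?z) \<le> r" using r(6) by (auto simp: dist_norm)
    moreover have "norm (z - ?z) = norm (x0 - x) + norm (y0 - y)"
      by (subst norm_split) (simp add: x0_def y0_def blinfun.bilinear_simps)
    ultimately show "?T \<le> r + e" using x(3) y(3) xy0 by (simp add: \<epsilon>_def)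
  qed
qed

lemma thickness_eq_min:
  assumes "\<exists>x :: 'x. x \<noteq> 0" "\<exists>y :: 'y. y \<noteq> 0"
    and "daugavet_property TYPE('x) \<or> daugavet_property TYPE('y)"
  shows "daugavet_thickness TYPE('z) = min (daugavet_thickness TYPE('x)) (daugavet_thickness TYPE('y))"
  using thickness_le_left[OF assms(1)] l1_decomposition.thickness_le_left[OF swap assms(2)]
    thickness_ge_right[OF _ assms(1,2)] l1_decomposition.thickness_ge_right[OF swap _ assms(2,1)] assms(3)
  by linarith

end

lemma l1_decomposition_l1_sum:
  "l1_decomposition (Blinfun (\<lambda>x. L1_Pair x 0)) (Blinfun (\<lambda>y. L1_Pair 0 y))
     (Blinfun l1_fst) (Blinfun (l1_snd :: ('a::real_normed_vector, 'b::real_normed_vector) l1_sum \<Rightarrow> 'b))"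
proof -
  have "bounded_linear (\<lambda>x. L1_Pair x 0 :: ('a, 'b) l1_sum)"
    "bounded_linear (\<lambda>y. L1_Pair 0 y :: ('a, 'b) l1_sum)"
    "bounded_linear (l1_fst :: ('a, 'b) l1_sum \<Rightarrow> 'a)" "bounded_linear (l1_snd :: ('a, 'b) l1_sum \<Rightarrow> 'b)"
    by (rule bounded_linear_intro[where K = 1];
        simp add: plus_l1_sum_def scaleR_l1_sum_def norm_l1_sum_def)+
  then show ?thesis
    by unfold_locales (auto simp: bounded_linear_Blinfun_apply norm_l1_sum_def)
qed

theorem mainTheorem2:
  assumes "\<exists>x :: 'a::banach. x \<noteq> 0"
    and "\<exists>y :: 'b::banach. y \<noteq> 0"
    and "daugavet_property TYPE('a) \<or> daugavet_property TYPE('b)"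
  shows "daugavet_thickness TYPE(('a, 'b) l1_sum) =
           min (daugavet_thickness TYPE('a)) (daugavet_thickness TYPE('b))"
  by (rule l1_decomposition.thickness_eq_min[OF l1_decomposition_l1_sum assms])

end
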